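(* For any fixed pair of optimal primal and Lagrangian dual solutions of the Combined Model with demand $P^D$, with $LME_i=p_{\pi,i}+p_o\pi_i$ for $i\in N$ and $SCI_\ell=p^+_{\rho,\ell}-p^-_{\rho,\ell}+p_o(\rho^+_\ell-\rho^-_\ell)$ for $\ell\in L$, the carbon accounts of all loads, generators and transmission lines sum to the total system carbon emissions: $$\sum_{g\in G}\sigma_gP^G_g=\sum_{i\in N}LME_iP^D_i+\sum_{g\in G}(\sigma_g-LME_g)P^G_g+\sum_{\ell\in L}SCI_\ell\,|f_\ell|.$$
   Context: **Data.** $N$ is a finite set of nodes, $G$ a finite set of generators, $G_i\subseteq G$ the set of generators at node $i$ (each generator lies at exactly one node), and $L$ a finite set of directed lines $\ell=(i,j)$ with admittance $B_\ell=B_{ij}$. Real parameters: costs $c_g$, unit emissions $\sigma_g$, generation limits $P^{min}_g,P^{max}_g$, flow limits $f^{max}_\ell$, demands $P^D_i$. A nodal quantity subscripted by a generator $g$ means its value at the node where $g$ is located (e.g. $LME_g:=LME_i$ for $g\in G_i$). **DC-OPF.** Minimize $c^TP^G$ over $(P^G,\theta,f)$ subject to $B_{ij}(\theta_i-\theta_j)-f_\ell=0$ for $\ell=(i,j)\in L$; $\sum_{g\in G_i}P^G_g-\sum_{\ell=(i,j)\in L}f_\ell+\sum_{\ell=(j,i)\in L}f_\ell-P^D_i=0$ for $i\in N$; $f_\ell\le f^{max}_\ell$ and $f_\ell\ge -f^{max}_\ell$ for $\ell\in L$; $P^G_g\le P^{max}_g$ and $P^G_g\ge P^{min}_g$ for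 $g\in G$. **Combined Model.** Minimize $\sigma^TP^G$ over $(P^G,\theta,f,\pi,\gamma^+,\gamma^-,\rho^+,\rho^-,z)$ subject to all DC-OPF constraints above together with the DC-OPF dual constraints $\gamma^+_g+\gamma^-_g+\sum_{i\mid g\in G_i}\pi_i=c_g$ ($g\in G$); $-z_\ell+\rho^+_\ell+\rho^-_\ell-\pi_i+\pi_j=0$ ($\ell=(i,j)\in L$); $\sum_{\ell=(i,j)\in L}B_\ell z_\ell-\sum_{\ell=(j,i)\in L}B_\ell z_\ell=0$ ($i\in N$); $\rho^+,\gamma^+\le 0$; $\rho^-,\gamma^-\ge0$; and the strong duality constraint $c^TP^G-\pi^TP^D-(\rho^+-\rho^-)^Tf^{max}-(\gamma^+)^TP^{max}-(\gamma^-)^TP^{min}\le 0$. **Multipliers.** $p$ denotes a Lagrangian dual solution of this linear program, with Lagrangian equal to the objective minus the sum of multiplier times (left side minus right side), so multipliers of $\le$ constraints are $\le0$, of $\ge$ constraints are $\ge0$, and of equalities are free. $p_{\pi,i}$ is the multiplier of the flow balance constraint at node $i$, $p^+_{\rho,\ell}$ that of $f_\ell\le f^{max}_\ell$, $p^-_{\rho,\ell}$ that of $f_\ell\ge-f^{max}_\ell$, and $p_o$ that of the strong duality constraint. **Carbon accounts.** The load at node $i$ has account $LME_iP^D_i$, generator $g$ has account $(\sigma_g-LME_g)P^G_g$, and line $\ell$ has account $SCI_\ell|f_\ell|$. *)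

theory Defs
  imports Complex_Main "HOL-Library.Extended_Real"
begin

text \<open>
  A line is the ordered pair of its end nodes. The generators at node \<open>i\<close> are given by the
  location map \<open>gen_node\<close>, so that each generator lies at exactly one node. Functions on nodes,
  generators and lines are only relevant on the carriers \<open>nodes\<close>, \<open>gens\<close>, \<open>lines\<close>.
\<close>

record ('n, 'g) network =
  nodes :: "'n set"
  gens :: "'g set"
  gen_node :: "'g \<Rightarrow> 'n"
  lines :: "('n \<times> 'n) set"
  adm :: "'n \<times> 'n \<Rightarrow> real"
  cost :: "'g \<Rightarrow> real"
  emis :: "'g \<Rightarrow> real"
  Pmin :: "'g \<Rightarrow> real"
  Pmax :: "'g \<Rightarrow> real"
  fmax :: "'n \<times> 'n \<Rightarrow> real"
  demand :: "'n \<Rightarrow> real"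

definition valid_network :: "('n, 'g) network \<Rightarrow> bool" where
  "valid_network S \<longleftrightarrow>
     finite (nodes S) \<and> finite (gens S) \<and> finite (lines S) \<and>
     gen_node S ` gens S \<subseteq> nodes S \<and> lines S \<subseteq> nodes S \<times> nodes S"

definition gens_at :: "('n, 'g) network \<Rightarrow> 'n \<Rightarrow> 'g set" where
  "gens_at S i = {g \<in> gens S. gen_node S g = i}"

definition lines_out :: "('n, 'g) network \<Rightarrow> 'n \<Rightarrow> ('n \<times> 'n) set" where
  "lines_out S i = {l \<in> lines S. fst l = i}"

definition lines_in :: "('n, 'g) network \<Rightarrow> 'n \<Rightarrow> ('n \<times> 'n) set" where
  "lines_in S i = {l \<in> lines S. snd l = i}"

record ('n, 'g) dcopf_vars =
  PG :: "'g \<Rightarrow> real"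
  theta :: "'n \<Rightarrow> real"
  flow :: "'n \<times> 'n \<Rightarrow> real"

record ('n, 'g) combined_vars = "('n, 'g) dcopf_vars" +
  pi_var :: "'n \<Rightarrow> real"
  gamma_up :: "'g \<Rightarrow> real"
  gamma_lo :: "'g \<Rightarrow> real"
  rho_up :: "'n \<times> 'n \<Rightarrow> real"
  rho_lo :: "'n \<times> 'n \<Rightarrow> real"
  z_var :: "'n \<times> 'n \<Rightarrow> real"


text \<open>
  For each constraint that is not a simple bound, the difference of its left and right hand side.
  These residuals occur both in the feasibility predicates and in the Lagrangian.
\<close>

definition flow_res ::
  "('n, 'g) network \<Rightarrow> ('n, 'g, 'z) dcopf_vars_scheme \<Rightarrow> 'n \<times> 'n \<Rightarrow> real" where
  "flow_res S x l = adm S l * (theta x (fst l) - theta x (snd l)) - flow x l"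

definition balance_res ::
  "('n, 'g) network \<Rightarrow> ('n, 'g, 'z) dcopf_vars_scheme \<Rightarrow> 'n \<Rightarrow> real" where
  "balance_res S x i =
     (\<Sum>g\<in>gens_at S i. PG x g) - (\<Sum>l\<in>lines_out S i. flow x l)
       + (\<Sum>l\<in>lines_in S i. flow x l) - demand S i"

definition dual_PG_res ::
  "('n, 'g) network \<Rightarrow> ('n, 'g) combined_vars \<Rightarrow> 'g \<Rightarrow> real" where
  "dual_PG_res S x g =
     gamma_up x g + gamma_lo x g + (\<Sum>i\<in>{i \<in> nodes S. g \<in> gens_at S i}. pi_var x i) - cost S g"

definition dual_flow_res ::
  "('n, 'g) network \<Rightarrow> ('n, 'g) combined_vars \<Rightarrow> 'n \<times> 'n \<Rightarrow> real" where
  "dual_flow_res S x l =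
     - z_var x l + rho_up x l + rho_lo x l - pi_var x (fst l) + pi_var x (snd l)"

definition dual_theta_res ::
  "('n, 'g) network \<Rightarrow> ('n, 'g) combined_vars \<Rightarrow> 'n \<Rightarrow> real" where
  "dual_theta_res S x i =
     (\<Sum>l\<in>lines_out S i. adm S l * z_var x l) - (\<Sum>l\<in>lines_in S i. adm S l * z_var x l)"

definition strong_duality_res ::
  "('n, 'g) network \<Rightarrow> ('n, 'g) combined_vars \<Rightarrow> real" where
  "strong_duality_res S x =
     (\<Sum>g\<in>gens S. cost S g * PG x g) - (\<Sum>i\<in>nodes S. pi_var x i * demand S i)
       - (\<Sum>l\<in>lines S. (rho_up x l - rho_lo x l) * fmax S l)
       - (\<Sum>g\<in>gens S. gamma_up x g * Pmax S g) - (\<Sum>g\<in>gens S. gamma_lo x g * Pmin S g)"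

definition dcopf_feasible ::
  "('n, 'g) network \<Rightarrow> ('n, 'g, 'z) dcopf_vars_scheme \<Rightarrow> bool" where
  "dcopf_feasible S x \<longleftrightarrow>
     (\<forall>l\<in>lines S. flow_res S x l = 0) \<and>
     (\<forall>i\<in>nodes S. balance_res S x i = 0) \<and>
     (\<forall>l\<in>lines S. flow x l \<le> fmax S l \<and> flow x l \<ge> - fmax S l) \<and>
     (\<forall>g\<in>gens S. PG x g \<le> Pmax S g \<and> PG x g \<ge> Pmin S g)"

definition dcopf_dual_feasible ::
  "('n, 'g) network \<Rightarrow> ('n, 'g) combined_vars \<Rightarrow> bool" where
  "dcopf_dual_feasible S x \<longleftrightarrow>
     (\<forall>g\<in>gens S. dual_PG_res S x g = 0) \<and>
     (\<forall>l\<in>lines S. dual_flow_res S x l = 0) \<and>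
     (\<forall>i\<in>nodes S. dual_theta_res S x i = 0) \<and>
     (\<forall>l\<in>lines S. rho_up x l \<le> 0 \<and> rho_lo x l \<ge> 0) \<and>
     (\<forall>g\<in>gens S. gamma_up x g \<le> 0 \<and> gamma_lo x g \<ge> 0)"

definition combined_feasible ::
  "('n, 'g) network \<Rightarrow> ('n, 'g) combined_vars \<Rightarrow> bool" where
  "combined_feasible S x \<longleftrightarrow>
     dcopf_feasible S x \<and> dcopf_dual_feasible S x \<and> strong_duality_res S x \<le> 0"

definition emissions :: "('n, 'g) network \<Rightarrow> ('n, 'g) combined_vars \<Rightarrow> real" where
  "emissions S x = (\<Sum>g\<in>gens S. emis S g * PG x g)"

definition combined_optimal ::
  "('n, 'g) network \<Rightarrow> ('n, 'g) combined_vars \<Rightarrow> bool" where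
  "combined_optimal S x \<longleftrightarrow>
     combined_feasible S x \<and> (\<forall>y. combined_feasible S y \<longrightarrow> emissions S x \<le> emissions S y)"


text \<open>
  One multiplier per constraint. The multipliers of the DC-OPF constraints are named after the
  DC-OPF dual variables, those of the DC-OPF dual constraints after the DC-OPF primal variables;
  the prefix \<open>p_sgn\<close> belongs to the sign constraints on the DC-OPF dual variables, and \<open>p_o\<close> to
  the strong duality constraint.
\<close>

record ('n, 'g) multipliers =
  p_z :: "'n \<times> 'n \<Rightarrow> real"
  p_pi :: "'n \<Rightarrow> real"
  p_rho_up :: "'n \<times> 'n \<Rightarrow> real"
  p_rho_lo :: "'n \<times> 'n \<Rightarrow> real"
  p_gamma_up :: "'g \<Rightarrow> real"
  p_gamma_lo :: "'g \<Rightarrow> real"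
  p_PG :: "'g \<Rightarrow> real"
  p_flow :: "'n \<times> 'n \<Rightarrow> real"
  p_theta :: "'n \<Rightarrow> real"
  p_sgn_rho_up :: "'n \<times> 'n \<Rightarrow> real"
  p_sgn_rho_lo :: "'n \<times> 'n \<Rightarrow> real"
  p_sgn_gamma_up :: "'g \<Rightarrow> real"
  p_sgn_gamma_lo :: "'g \<Rightarrow> real"
  p_o :: real

definition multiplier_signs :: "('n, 'g) network \<Rightarrow> ('n, 'g) multipliers \<Rightarrow> bool" where
  "multiplier_signs S p \<longleftrightarrow>
     (\<forall>l\<in>lines S. p_rho_up p l \<le> 0 \<and> p_rho_lo p l \<ge> 0) \<and>
     (\<forall>g\<in>gens S. p_gamma_up p g \<le> 0 \<and> p_gamma_lo p g \<ge> 0) \<and>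
     (\<forall>l\<in>lines S. p_sgn_rho_up p l \<le> 0 \<and> p_sgn_rho_lo p l \<ge> 0) \<and>
     (\<forall>g\<in>gens S. p_sgn_gamma_up p g \<le> 0 \<and> p_sgn_gamma_lo p g \<ge> 0) \<and>
     p_o p \<le> 0"

definition lagrangian ::
  "('n, 'g) network \<Rightarrow> ('n, 'g) combined_vars \<Rightarrow> ('n, 'g) multipliers \<Rightarrow> real" where
  "lagrangian S x p =
     emissions S x
     - ((\<Sum>l\<in>lines S. p_z p l * flow_res S x l)
      + (\<Sum>i\<in>nodes S. p_pi p i * balance_res S x i)
      + (\<Sum>l\<in>lines S. p_rho_up p l * (flow x l - fmax S l))
      + (\<Sum>l\<in>lines S. p_rho_lo p l * (flow x l - (- fmax S l)))
      + (\<Sum>g\<in>gens S. p_gamma_up p g * (PG x g - Pmax S g))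
      + (\<Sum>g\<in>gens S. p_gamma_lo p g * (PG x g - Pmin S g))
      + (\<Sum>g\<in>gens S. p_PG p g * dual_PG_res S x g)
      + (\<Sum>l\<in>lines S. p_flow p l * dual_flow_res S x l)
      + (\<Sum>i\<in>nodes S. p_theta p i * dual_theta_res S x i)
      + (\<Sum>l\<in>lines S. p_sgn_rho_up p l * rho_up x l)
      + (\<Sum>l\<in>lines S. p_sgn_rho_lo p l * rho_lo x l)
      + (\<Sum>g\<in>gens S. p_sgn_gamma_up p g * gamma_up x g)
      + (\<Sum>g\<in>gens S. p_sgn_gamma_lo p g * gamma_lo x g)
      + p_o p * strong_duality_res S x)"

definition dual_function ::
  "('n, 'g) network \<Rightarrow> ('n, 'g) multipliers \<Rightarrow> ereal" where
  "dual_function S p = (INF x. ereal (lagrangian S x p))"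

definition lagrangian_dual_optimal ::
  "('n, 'g) network \<Rightarrow> ('n, 'g) multipliers \<Rightarrow> bool" where
  "lagrangian_dual_optimal S p \<longleftrightarrow>
     multiplier_signs S p \<and>
     (\<forall>q. multiplier_signs S q \<longrightarrow> dual_function S q \<le> dual_function S p)"


definition LME :: "('n, 'g) combined_vars \<Rightarrow> ('n, 'g) multipliers \<Rightarrow> 'n \<Rightarrow> real" where
  "LME x p i = p_pi p i + p_o p * pi_var x i"

definition SCI :: "('n, 'g) combined_vars \<Rightarrow> ('n, 'g) multipliers \<Rightarrow> 'n \<times> 'n \<Rightarrow> real" where
  "SCI x p l = p_rho_up p l - p_rho_lo p l + p_o p * (rho_up x l - rho_lo x l)"

definition load_account ::
  "('n, 'g) network \<Rightarrow> ('n, 'g) combined_vars \<Rightarrow> ('n, 'g) multipliers \<Rightarrow> 'n \<Rightarrow> real" where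
  "load_account S x p i = LME x p i * demand S i"

definition gen_account ::
  "('n, 'g) network \<Rightarrow> ('n, 'g) combined_vars \<Rightarrow> ('n, 'g) multipliers \<Rightarrow> 'g \<Rightarrow> real" where
  "gen_account S x p g = (emis S g - LME x p (gen_node S g)) * PG x g"

definition line_account ::
  "('n, 'g) combined_vars \<Rightarrow> ('n, 'g) multipliers \<Rightarrow> 'n \<times> 'n \<Rightarrow> real" where
  "line_account x p l = SCI x p l * \<bar>flow x l\<bar>"

end

theory Submission
  imports Defs
begin

text \<open>
  Weighting the flow balance equations with the prices \<open>LME\<close> turns the identity into a statement
  about lines only: what generators receive at these prices minus what loads pay is
  \<open>\<Sum>l. (LME (fst l) - LME (snd l)) * flow l\<close> (\<open>priced_balance\<close>), and this amount has to
  agree with \<open>\<Sum>l. SCI l * \<bar>flow l\<bar>\<close>. Since \<open>LME = p_pi + p_o * pi_var\<close>, it splits into two parts of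
  the same shape.

  For the prices \<open>pi_var\<close>, feasibility for the DC-OPF dual gives
  \<open>\<Sum>l. (rho_up l + rho_lo l) * flow l\<close> (\<open>congestion_rent_cost\<close>): the remaining term with \<open>z_var\<close>
  vanishes because \<open>flow\<close> comes from a potential \<open>theta\<close> and \<open>adm * z_var\<close> is a circulation. For the
  prices \<open>p_pi\<close>, the Lagrangian does not change when flows and angles are scaled to zero together,
  which gives \<open>\<Sum>l. (p_rho_up l + p_rho_lo l) * flow l\<close> (\<open>congestion_rent_emissions\<close>).

  Complementary slackness then brings in the absolute value: an upper multiplier can be nonzero only
  if \<open>flow = fmax = \<bar>flow\<bar>\<close>, a lower one only if \<open>flow = - fmax = - \<bar>flow\<bar>\<close>, so that sums of
  multipliers times \<open>flow\<close> become differences times \<open>\<bar>flow\<bar>\<close> (\<open>slackness_abs_flow\<close>). For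
  \<open>rho_up\<close> and \<open>rho_lo\<close> slackness follows from the strong duality constraint, whose residual is a sum
  of nonnegative slackness products.

  For the multipliers \<open>p\<close>, slackness and invariance of the Lagrangian require that there is no duality
  gap in the Combined Model: only then does an arbitrary dual optimum have the value \<open>emissions S x\<close>.
  This is linear programming duality, obtained from Farkas' lemma at the primal optimum
  (\<open>farkas\<close>, \<open>optimal_imp_multipliers\<close>, \<open>combined_optimal_imp_dual_attained\<close>).
\<close>


section \<open>Multipliers for affine programs\<close>

text \<open>
  The points of a linear program need not form a vector space type (here they are records of
  functions). All that duality uses of the vector structure is the operation
  \<open>step b x t y = x + t * (y - b)\<close>, and affinity of a function is its compatibility with it.
\<close>

definition affine_along :: "('v \<Rightarrow> 'v \<Rightarrow> real \<Rightarrow> 'v \<Rightarrow> 'v) \<Rightarrow> ('v \<Rightarrow> real) \<Rightarrow> bool" where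
  "affine_along step f \<longleftrightarrow> (\<forall>b x t y. f (step b x t y) = f x + t * (f y - f b))"

definition satisfied :: "('k \<Rightarrow> bool) \<Rightarrow> 'k \<Rightarrow> real \<Rightarrow> bool" where
  "satisfied eq k r \<longleftrightarrow> (if eq k then r = 0 else r \<le> 0)"

text \<open>
  Induction on the number of constraints. If the new constraint \<open>m\<close> matters, some \<open>u\<close> satisfies the
  others, has \<open>c u > 0\<close> and must violate \<open>m\<close>. Projecting along \<open>u\<close> onto the kernel of \<open>a m\<close> makes
  \<open>m\<close> hold automatically, so the induction hypothesis applies to the projected functionals, and the
  multiplier of \<open>m\<close> collects the correction terms; its sign comes from the choice of \<open>u\<close>.
  Linearity is stated through a single operation, to be thought of as \<open>comb x t y = x + t * y\<close>.
\<close>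

lemma farkas:
  fixes comb :: "'v \<Rightarrow> real \<Rightarrow> 'v \<Rightarrow> 'v" and a :: "'k \<Rightarrow> 'v \<Rightarrow> real"
  assumes "finite K"
    and "\<And>k x t y. k \<in> K \<Longrightarrow> a k (comb x t y) = a k x + t * a k y"
    and "\<And>x t y. c (comb x t y) = c x + t * c y"
    and "\<And>x. \<forall>k\<in>K. satisfied eq k (a k x) \<Longrightarrow> c x \<le> 0"
  shows "\<exists>w. (\<forall>k\<in>K. \<not> eq k \<longrightarrow> 0 \<le> w k) \<and> (\<forall>x. c x = (\<Sum>k\<in>K. w k * a k x))"
  using assms
proof (induction K arbitrary: a c rule: finite_induct)
  case empty
  \<comment> \<open>\<open>comb x (- 2) x\<close> plays the role of \<open>- x\<close>.\<close>
  have "c x = 0" for x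
    using empty(3)[of x] empty(3)[of "comb x (- 2) x"] by (simp add: empty(2))
  then show ?case by simp
next
  case (insert m K)
  show ?case
  proof (cases "\<forall>x. (\<forall>k\<in>K. satisfied eq k (a k x)) \<longrightarrow> c x \<le> 0")
    case True
    then obtain w where w: "\<forall>k\<in>K. \<not> eq k \<longrightarrow> 0 \<le> w k" "\<forall>x. c x = (\<Sum>k\<in>K. w k * a k x)"
      using insert.IH[of a c] insert.prems by auto
    have "(\<Sum>k\<in>K. (w(m := 0)) k * a k x) = (\<Sum>k\<in>K. w k * a k x)" for x
      by (rule sum.cong) (use insert.hyps in auto)
    then show ?thesis
      using w insert.hyps by (intro exI[of _ "w(m := 0)"]) auto
  next
    case False
    then obtain u where u: "\<forall>k\<in>K. satisfied eq k (a k u)" and cu: "c u > 0"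
      by force
    have viol: "\<not> satisfied eq m (a m u)"
      using insert.prems(3)[of u] u cu by auto
    then have am0: "a m u \<noteq> 0" by (auto simp: satisfied_def split: if_splits)
    \<comment> \<open>Functionals pulled back along the projection to the kernel of \<open>a m\<close> parallel to \<open>u\<close>.\<close>
    define a' where "a' k x = a k x - a k u / a m u * a m x" for k x
    define c' where "c' x = c x - c u / a m u * a m x" for x
    have lin_a: "a k (comb x t y) = a k x + t * a k y" if "k \<in> insert m K" for k x t y
      using insert.prems(1) that .
    have "\<exists>w. (\<forall>k\<in>K. \<not> eq k \<longrightarrow> 0 \<le> w k) \<and> (\<forall>x. c' x = (\<Sum>k\<in>K. w k * a' k x))"
    proof (rule insert.IH)
      show "a' k (comb x t y) = a' k x + t * a' k y" if "k \<in> K" for k x t y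
        using that by (simp add: a'_def lin_a algebra_simps)
      show "c' (comb x t y) = c' x + t * c' y" for x t y
        by (simp add: c'_def lin_a insert.prems(2) algebra_simps)
      show "c' x \<le> 0" if sat: "\<forall>k\<in>K. satisfied eq k (a' k x)" for x
      proof -
        let ?y = "comb x (- a m x / a m u) u"
        have "a m ?y = 0" using am0 by (simp add: lin_a)
        moreover have "a k ?y = a' k x" if "k \<in> K" for k
          using that by (simp add: lin_a a'_def)
        ultimately have "c ?y \<le> 0"
          using sat by (intro insert.prems(3)) (auto simp: satisfied_def)
        then show ?thesis by (simp add: c'_def insert.prems(2) mult.commute)
      qed
    qed
    then obtain w where w0: "\<forall>k\<in>K. \<not> eq k \<longrightarrow> 0 \<le> w k"
      and w: "\<And>x. c' x = (\<Sum>k\<in>K. w k * a' k x)" by blast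
    define v where "v = (c u - (\<Sum>k\<in>K. w k * a k u)) / a m u"
    have c_eq: "c x = (\<Sum>k\<in>K. w k * a k x) + v * a m x" for x
    proof -
      have "(\<Sum>k\<in>K. w k * a' k x)
          = (\<Sum>k\<in>K. w k * a k x) - (\<Sum>k\<in>K. w k * a k u) / a m u * a m x"
        by (simp add: a'_def algebra_simps sum_subtractf sum_distrib_left sum_divide_distrib)
      then show ?thesis
        using w[of x] by (simp add: c'_def v_def diff_divide_distrib algebra_simps)
    qed
    have "v \<ge> 0" if "\<not> eq m"
    proof -
      have "(\<Sum>k\<in>K. w k * a k u) \<le> 0"
        using u w0 by (intro sum_nonpos) (auto simp: satisfied_def mult_le_0_iff split: if_splits)
      moreover have "a m u > 0" using viol that by (auto simp: satisfied_def)
      ultimately show ?thesis using cu by (simp add: v_def)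
    qed
    moreover have "(\<Sum>k\<in>K. (w(m := v)) k * a k x) = (\<Sum>k\<in>K. w k * a k x)" for x
      by (rule sum.cong) (use insert.hyps in auto)
    ultimately show ?thesis
      using w0 c_eq insert.hyps by (intro exI[of _ "w(m := v)"]) auto
  qed
qed

lemma short_step_keeps_negative:
  fixes r s :: "'k \<Rightarrow> real"
  assumes "finite K" and "\<And>k. k \<in> K \<Longrightarrow> r k < 0"
  shows "\<exists>t>0. \<forall>k\<in>K. r k + t * s k \<le> 0"
proof -
  have "\<forall>\<^sub>F t in at_right 0. r k + t * s k < 0" if "k \<in> K" for k
  proof (rule order_tendstoD)
    show "((\<lambda>t. r k + t * s k) \<longlongrightarrow> r k + 0 * s k) (at_right 0)"
      by (intro tendsto_intros)
  qed (use assms(2) that in simp)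
  then have "\<forall>\<^sub>F t in at_right 0. \<forall>k\<in>K. r k + t * s k < 0"
    using assms(1) by (simp add: eventually_ball_finite)
  then obtain b :: real where "b > 0" "\<forall>t>0. t < b \<longrightarrow> (\<forall>k\<in>K. r k + t * s k < 0)"
    unfolding eventually_at_right_field by blast
  then show ?thesis
    by (metis dense less_imp_le)
qed

text \<open>
  Every direction that keeps the constraints active at \<open>x\<close> satisfied to first order stays feasible
  for a short step, so the objective cannot decrease along it. Farkas' lemma for the active
  constraints yields the multipliers, and inactive constraints get multiplier zero. Differences to
  the values at \<open>x\<close> are linear with respect to \<open>step x\<close>, which thus serves as the linear combination.
\<close>

lemma optimal_imp_multipliers:
  fixes step :: "'v \<Rightarrow> 'v \<Rightarrow> real \<Rightarrow> 'v \<Rightarrow> 'v" and F :: "'k \<Rightarrow> 'v \<Rightarrow> real"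
  assumes fin: "finite K"
    and affF: "\<And>k. k \<in> K \<Longrightarrow> affine_along step (F k)"
    and affo: "affine_along step obj"
    and feas: "\<forall>k\<in>K. satisfied eq k (F k x)"
    and opt: "\<And>y. \<forall>k\<in>K. satisfied eq k (F k y) \<Longrightarrow> obj x \<le> obj y"
  shows "\<exists>w. (\<forall>k\<in>K. \<not> eq k \<longrightarrow> 0 \<le> w k) \<and> (\<forall>y. obj y + (\<Sum>k\<in>K. w k * F k y) = obj x)"
proof -
  define A where "A = {k \<in> K. F k x = 0}"
  have A: "A \<subseteq> K" "finite A" using fin by (auto simp: A_def)
  have "\<exists>w. (\<forall>k\<in>A. \<not> eq k \<longrightarrow> 0 \<le> w k) \<and>
      (\<forall>y. obj x - obj y = (\<Sum>k\<in>A. w k * (F k y - F k x)))"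
  proof (rule farkas[where comb = "step x"])
    show "finite A" by (rule A)
    show "F k (step x y t z) - F k x = F k y - F k x + t * (F k z - F k x)"
      if "k \<in> A" for k y t z
      using affF that A by (auto simp: affine_along_def)
    show "obj x - obj (step x y t z) = obj x - obj y + t * (obj x - obj z)" for y t z
      using affo by (simp add: affine_along_def algebra_simps)
  next
    fix y assume y: "\<forall>k\<in>A. satisfied eq k (F k y - F k x)"
    have "F k x < 0" if "k \<in> K - A" for k
      using that feas by (force simp: A_def satisfied_def split: if_splits)
    then obtain t where t: "t > 0" "\<forall>k\<in>K - A. F k x + t * (F k y - F k x) \<le> 0"
      using short_step_keeps_negative[of "K - A" "\<lambda>k. F k x" "\<lambda>k. F k y - F k x"] fin by auto
    have "satisfied eq k (F k (step x x t y))" if "k \<in> K" for k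
    proof -
      have Fk: "F k (step x x t y) = F k x + t * (F k y - F k x)"
        using affF[OF that] by (simp add: affine_along_def)
      show ?thesis
      proof (cases "k \<in> A")
        case True
        then show ?thesis
          using y t(1) unfolding Fk
          by (auto simp: A_def satisfied_def mult_le_0_iff)
      next
        case False
        then have "\<not> eq k" using feas that by (auto simp: A_def satisfied_def)
        then show ?thesis
          using t(2) that False unfolding Fk by (simp add: satisfied_def)
      qed
    qed
    then have "obj x \<le> obj (step x x t y)" by (intro opt) simp
    then show "obj x - obj y \<le> 0"
      using affo t(1) by (simp add: affine_along_def zero_le_mult_iff)
  qed
  then obtain w where w0: "\<forall>k\<in>A. \<not> eq k \<longrightarrow> 0 \<le> w k"
    and w: "\<And>y. obj x - obj y = (\<Sum>k\<in>A. w k * (F k y - F k x))" by blast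
  define w' where "w' k = (if k \<in> A then w k else 0)" for k
  have "(\<Sum>k\<in>K. w' k * F k y) = (\<Sum>k\<in>A. w k * (F k y - F k x))" for y
    by (rule sum.mono_neutral_cong_right) (use fin A in \<open>auto simp: w'_def A_def\<close>)
  then show ?thesis
    using w0 by (intro exI[of _ w']) (auto simp: w'_def w[symmetric])
qed

lemma affine_bounded_below_imp_const:
  assumes "affine_along step f" and "\<And>y. m \<le> f y"
  shows "f y = f x"
proof (rule ccontr)
  assume "f y \<noteq> f x"
  \<comment> \<open>The step length at which \<open>f\<close> takes the value \<open>m - 1\<close>.\<close>
  then have "f (step x x ((m - f x - 1) / (f y - f x)) y) = m - 1"
    using assms(1) by (simp add: affine_along_def)
  then show False
    using assms(2)[of "step x x ((m - f x - 1) / (f y - f x)) y"] by simp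
qed

lemma affine_along_const: "affine_along step (\<lambda>x. c)"
  by (simp add: affine_along_def)

lemma affine_along_add:
  "affine_along step f \<Longrightarrow> affine_along step g \<Longrightarrow> affine_along step (\<lambda>x. f x + g x)"
  by (simp add: affine_along_def algebra_simps)

lemma affine_along_diff:
  "affine_along step f \<Longrightarrow> affine_along step g \<Longrightarrow> affine_along step (\<lambda>x. f x - g x)"
  by (simp add: affine_along_def algebra_simps)

lemma affine_along_minus: "affine_along step f \<Longrightarrow> affine_along step (\<lambda>x. - f x)"
  by (simp add: affine_along_def algebra_simps)

lemma affine_along_cmult: "affine_along step f \<Longrightarrow> affine_along step (\<lambda>x. c * f x)"
  by (simp add: affine_along_def) (simp add: algebra_simps)

lemma affine_along_multc: "affine_along step f \<Longrightarrow> affine_along step (\<lambda>x. f x * c)"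
  by (simp add: affine_along_def) (simp add: algebra_simps)

lemma affine_along_sum:
  "(\<And>i. i \<in> A \<Longrightarrow> affine_along step (f i)) \<Longrightarrow> affine_along step (\<lambda>x. \<Sum>i\<in>A. f i x)"
  by (simp add: affine_along_def sum.distrib sum_distrib_left sum_subtractf
      flip: sum_subtractf)

lemmas affine_intros = affine_along_const affine_along_add affine_along_diff affine_along_minus
  affine_along_cmult affine_along_multc affine_along_sum


section \<open>The Combined Model as an affine program\<close>

definition shift ::
  "('n, 'g) combined_vars \<Rightarrow> ('n, 'g) combined_vars \<Rightarrow> real \<Rightarrow> ('n, 'g) combined_vars
    \<Rightarrow> ('n, 'g) combined_vars" where
  "shift b x t y =
     \<lparr>PG = \<lambda>g. PG x g + t * (PG y g - PG b g),
      theta = \<lambda>i. theta x i + t * (theta y i - theta b i),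
      flow = \<lambda>l. flow x l + t * (flow y l - flow b l),
      pi_var = \<lambda>i. pi_var x i + t * (pi_var y i - pi_var b i),
      gamma_up = \<lambda>g. gamma_up x g + t * (gamma_up y g - gamma_up b g),
      gamma_lo = \<lambda>g. gamma_lo x g + t * (gamma_lo y g - gamma_lo b g),
      rho_up = \<lambda>l. rho_up x l + t * (rho_up y l - rho_up b l),
      rho_lo = \<lambda>l. rho_lo x l + t * (rho_lo y l - rho_lo b l),
      z_var = \<lambda>l. z_var x l + t * (z_var y l - z_var b l)\<rparr>"

lemma affine_along_shift_coords:
  "affine_along shift (\<lambda>x. PG x g)" "affine_along shift (\<lambda>x. theta x i)"
  "affine_along shift (\<lambda>x. flow x l)" "affine_along shift (\<lambda>x. pi_var x i)"
  "affine_along shift (\<lambda>x. gamma_up x g)" "affine_along shift (\<lambda>x. gamma_lo x g)"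
  "affine_along shift (\<lambda>x. rho_up x l)" "affine_along shift (\<lambda>x. rho_lo x l)"
  "affine_along shift (\<lambda>x. z_var x l)"
  by (simp_all add: affine_along_def shift_def)

lemma affine_along_shift_residuals:
  "affine_along shift (\<lambda>x. flow_res S x l)" "affine_along shift (\<lambda>x. balance_res S x i)"
  "affine_along shift (\<lambda>x. dual_PG_res S x g)" "affine_along shift (\<lambda>x. dual_flow_res S x l)"
  "affine_along shift (\<lambda>x. dual_theta_res S x i)" "affine_along shift (strong_duality_res S)"
  "affine_along shift (emissions S)"
  unfolding flow_res_def balance_res_def dual_PG_res_def dual_flow_res_def dual_theta_res_def
    strong_duality_res_def[abs_def] emissions_def[abs_def]
  by (intro affine_intros affine_along_shift_coords)+

lemma affine_along_shift_lagrangian: "affine_along shift (\<lambda>x. lagrangian S x p)"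
  unfolding lagrangian_def
  by (intro affine_intros affine_along_shift_coords affine_along_shift_residuals)

text \<open>
  One index type for all constraints, so that the multipliers of the whole program form a single
  function, as \<open>optimal_imp_multipliers\<close> delivers them.
\<close>

datatype ('n, 'g) constr =
    Flow "'n \<times> 'n" | Balance 'n
  | Flow_Up "'n \<times> 'n" | Flow_Lo "'n \<times> 'n" | Gen_Up 'g | Gen_Lo 'g
  | Dual_Gen 'g | Dual_Flow "'n \<times> 'n" | Dual_Theta 'n
  | Sgn_Rho_Up "'n \<times> 'n" | Sgn_Rho_Lo "'n \<times> 'n" | Sgn_Gamma_Up 'g | Sgn_Gamma_Lo 'g
  | Strong_Duality

fun is_equation :: "('n, 'g) constr \<Rightarrow> bool" where
  "is_equation (Flow l) = True"
| "is_equation (Balance i) = True"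
| "is_equation (Dual_Gen g) = True"
| "is_equation (Dual_Flow l) = True"
| "is_equation (Dual_Theta i) = True"
| "is_equation _ = False"

text \<open>Lower bounds are negated, so that every inequality reads \<open>residual \<le> 0\<close>.\<close>

fun residual :: "('n, 'g) network \<Rightarrow> ('n, 'g) constr \<Rightarrow> ('n, 'g) combined_vars \<Rightarrow> real" where
  "residual S (Flow l) x = flow_res S x l"
| "residual S (Balance i) x = balance_res S x i"
| "residual S (Flow_Up l) x = flow x l - fmax S l"
| "residual S (Flow_Lo l) x = - (flow x l - (- fmax S l))"
| "residual S (Gen_Up g) x = PG x g - Pmax S g"
| "residual S (Gen_Lo g) x = - (PG x g - Pmin S g)"
| "residual S (Dual_Gen g) x = dual_PG_res S x g"
| "residual S (Dual_Flow l) x = dual_flow_res S x l"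
| "residual S (Dual_Theta i) x = dual_theta_res S x i"
| "residual S (Sgn_Rho_Up l) x = rho_up x l"
| "residual S (Sgn_Rho_Lo l) x = - rho_lo x l"
| "residual S (Sgn_Gamma_Up g) x = gamma_up x g"
| "residual S (Sgn_Gamma_Lo g) x = - gamma_lo x g"
| "residual S Strong_Duality x = strong_duality_res S x"

definition constrs :: "('n, 'g) network \<Rightarrow> ('n, 'g) constr set" where
  "constrs S =
     Flow ` lines S \<union> (Balance ` nodes S \<union> (Flow_Up ` lines S \<union> (Flow_Lo ` lines S \<union>
     (Gen_Up ` gens S \<union> (Gen_Lo ` gens S \<union> (Dual_Gen ` gens S \<union> (Dual_Flow ` lines S \<union>
     (Dual_Theta ` nodes S \<union> (Sgn_Rho_Up ` lines S \<union> (Sgn_Rho_Lo ` lines S \<union>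
     (Sgn_Gamma_Up ` gens S \<union> (Sgn_Gamma_Lo ` gens S \<union> {Strong_Duality}))))))))))))"

lemma finite_constrs: "valid_network S \<Longrightarrow> finite (constrs S)"
  by (simp add: constrs_def valid_network_def)

lemma affine_along_shift_residual: "affine_along shift (residual S k)"
proof (cases k)
qed (simp_all add: affine_along_def algebra_simps
    affine_along_shift_coords[unfolded affine_along_def, rule_format]
    affine_along_shift_residuals[unfolded affine_along_def, rule_format])

lemma combined_feasible_iff_residuals:
  "combined_feasible S x \<longleftrightarrow> (\<forall>k\<in>constrs S. satisfied is_equation k (residual S k x))"
  unfolding combined_feasible_def dcopf_feasible_def dcopf_dual_feasible_def constrs_def
    satisfied_def
  by (simp add: ball_Un) (auto simp: algebra_simps)

lemma sum_constrs:
  fixes h :: "('n, 'g) constr \<Rightarrow> real"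
  assumes "valid_network S"
  shows "(\<Sum>k\<in>constrs S. h k) =
     (\<Sum>l\<in>lines S. h (Flow l)) + (\<Sum>i\<in>nodes S. h (Balance i))
   + (\<Sum>l\<in>lines S. h (Flow_Up l)) + (\<Sum>l\<in>lines S. h (Flow_Lo l))
   + (\<Sum>g\<in>gens S. h (Gen_Up g)) + (\<Sum>g\<in>gens S. h (Gen_Lo g))
   + (\<Sum>g\<in>gens S. h (Dual_Gen g)) + (\<Sum>l\<in>lines S. h (Dual_Flow l))
   + (\<Sum>i\<in>nodes S. h (Dual_Theta i))
   + (\<Sum>l\<in>lines S. h (Sgn_Rho_Up l)) + (\<Sum>l\<in>lines S. h (Sgn_Rho_Lo l))
   + (\<Sum>g\<in>gens S. h (Sgn_Gamma_Up g)) + (\<Sum>g\<in>gens S. h (Sgn_Gamma_Lo g))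
   + h Strong_Duality"
proof -
  have fin: "finite (nodes S)" "finite (gens S)" "finite (lines S)"
    using assms by (auto simp: valid_network_def)
  have peel: "sum h (C ` A \<union> B) = (\<Sum>a\<in>A. h (C a)) + sum h B"
    if "inj C" "finite A" "finite B" "C ` A \<inter> B = {}" for C :: "'b \<Rightarrow> ('n, 'g) constr" and A B
    using that by (simp add: sum.union_disjoint sum.reindex inj_on_def inj_def)
  show ?thesis
    unfolding constrs_def
    by (subst peel, simp add: inj_def, simp add: fin, simp add: fin, blast)+ simp
qed

text \<open>
  Strong duality: the dual function at \<open>q\<close> is the optimal primal value, as the Lagrangian is constant.
  The multipliers change sign because the Lagrangian subtracts the constraint terms; for
  \<open>\<ge>\<close> constraints the negation in the residual cancels this change.
\<close>

lemma combined_optimal_imp_dual_attained: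
  assumes "valid_network S" and "combined_optimal S x"
  obtains q where "multiplier_signs S q" and "\<And>y. lagrangian S y q = emissions S x"
proof -
  have "\<exists>w. (\<forall>k\<in>constrs S. \<not> is_equation k \<longrightarrow> 0 \<le> w k) \<and>
      (\<forall>y. emissions S y + (\<Sum>k\<in>constrs S. w k * residual S k y) = emissions S x)"
    using assms(2) unfolding combined_optimal_def combined_feasible_iff_residuals
    by (intro optimal_imp_multipliers[where step = shift])
       (auto simp: finite_constrs assms(1) affine_along_shift_residual
         affine_along_shift_residuals)
  then obtain w where w0: "\<forall>k\<in>constrs S. \<not> is_equation k \<longrightarrow> 0 \<le> w k"
    and w: "\<And>y. emissions S y + (\<Sum>k\<in>constrs S. w k * residual S k y) = emissions S x"
    by blast
  define q where "q = \<lparr>p_z = \<lambda>l. - w (Flow l), p_pi = \<lambda>i. - w (Balance i),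
    p_rho_up = \<lambda>l. - w (Flow_Up l), p_rho_lo = \<lambda>l. w (Flow_Lo l),
    p_gamma_up = \<lambda>g. - w (Gen_Up g), p_gamma_lo = \<lambda>g. w (Gen_Lo g),
    p_PG = \<lambda>g. - w (Dual_Gen g), p_flow = \<lambda>l. - w (Dual_Flow l),
    p_theta = \<lambda>i. - w (Dual_Theta i),
    p_sgn_rho_up = \<lambda>l. - w (Sgn_Rho_Up l), p_sgn_rho_lo = \<lambda>l. w (Sgn_Rho_Lo l),
    p_sgn_gamma_up = \<lambda>g. - w (Sgn_Gamma_Up g), p_sgn_gamma_lo = \<lambda>g. w (Sgn_Gamma_Lo g),
    p_o = - w Strong_Duality\<rparr>"
  have "multiplier_signs S q"
    using w0 by (simp add: multiplier_signs_def q_def constrs_def ball_Un)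
  moreover have "lagrangian S y q = emissions S x" for y
    unfolding w[of y, symmetric] sum_constrs[OF assms(1)] lagrangian_def q_def
    by (simp add: sum_negf del: minus_diff_eq minus_add_distrib)
  ultimately show thesis by (rule that)
qed


section \<open>Consequences of optimality\<close>

lemma dual_optimal_lagrangian_bound:
  assumes "valid_network S" and "combined_optimal S x" and "lagrangian_dual_optimal S p"
  shows "emissions S x \<le> lagrangian S y p"
proof -
  obtain q where q: "multiplier_signs S q" "\<And>y. lagrangian S y q = emissions S x"
    using combined_optimal_imp_dual_attained[OF assms(1,2)] by blast
  have "ereal (emissions S x) = dual_function S q"
    by (simp add: dual_function_def q(2))
  also have "\<dots> \<le> dual_function S p"
    using assms(3) q(1) by (simp add: lagrangian_dual_optimal_def)
  also have "\<dots> \<le> ereal (lagrangian S y p)"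
    unfolding dual_function_def by (rule INF_lower) simp
  finally show ?thesis by simp
qed

text \<open>
  At a feasible point all constraint terms of the Lagrangian are nonnegative, so the Lagrangian can
  reach the objective value only if each of them vanishes.
\<close>

lemma flow_limit_slackness:
  assumes "valid_network S" and "combined_feasible S x" and "multiplier_signs S p"
    and "emissions S x \<le> lagrangian S x p" and "l \<in> lines S"
  shows "p_rho_up p l * (flow x l - fmax S l) = 0"
    and "p_rho_lo p l * (flow x l - (- fmax S l)) = 0"
proof -
  note feas = assms(2)[unfolded combined_feasible_def dcopf_feasible_def dcopf_dual_feasible_def]
  note sgn = assms(3)[unfolded multiplier_signs_def]
  have fin: "finite (lines S)" using assms(1) by (simp add: valid_network_def)
  let ?up = "\<lambda>l. p_rho_up p l * (flow x l - fmax S l)"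
  let ?lo = "\<lambda>l. p_rho_lo p l * (flow x l - (- fmax S l))"
  have up: "?up l \<ge> 0" and lo: "?lo l \<ge> 0" if "l \<in> lines S" for l
    using feas sgn that by (auto intro: mult_nonpos_nonpos mult_nonneg_nonneg)
  have other:
    "(\<Sum>g\<in>gens S. p_gamma_up p g * (PG x g - Pmax S g)) \<ge> 0"
    "(\<Sum>g\<in>gens S. p_gamma_lo p g * (PG x g - Pmin S g)) \<ge> 0"
    "(\<Sum>l\<in>lines S. p_sgn_rho_up p l * rho_up x l) \<ge> 0"
    "(\<Sum>l\<in>lines S. p_sgn_rho_lo p l * rho_lo x l) \<ge> 0"
    "(\<Sum>g\<in>gens S. p_sgn_gamma_up p g * gamma_up x g) \<ge> 0"
    "(\<Sum>g\<in>gens S. p_sgn_gamma_lo p g * gamma_lo x g) \<ge> 0"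
    "p_o p * strong_duality_res S x \<ge> 0"
    using feas sgn by (auto intro!: sum_nonneg simp: zero_le_mult_iff)
  have eqs: "(\<Sum>l\<in>lines S. p_z p l * flow_res S x l) = 0"
    "(\<Sum>i\<in>nodes S. p_pi p i * balance_res S x i) = 0"
    "(\<Sum>g\<in>gens S. p_PG p g * dual_PG_res S x g) = 0"
    "(\<Sum>l\<in>lines S. p_flow p l * dual_flow_res S x l) = 0"
    "(\<Sum>i\<in>nodes S. p_theta p i * dual_theta_res S x i) = 0"
    using feas by auto
  have "(\<Sum>l\<in>lines S. ?up l) \<ge> 0" "(\<Sum>l\<in>lines S. ?lo l) \<ge> 0"
    using up lo by (auto intro!: sum_nonneg)
  then have "(\<Sum>l\<in>lines S. ?up l) = 0" "(\<Sum>l\<in>lines S. ?lo l) = 0"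
    using assms(4) other eqs unfolding lagrangian_def by linarith+
  then show "?up l = 0" "?lo l = 0"
    using sum_nonneg_eq_0_iff[OF fin, of ?up] sum_nonneg_eq_0_iff[OF fin, of ?lo]
      up lo assms(5) by blast+
qed

lemma sum_node_net_outflow:
  fixes u :: "'n \<Rightarrow> real" and h :: "'n \<times> 'n \<Rightarrow> real"
  assumes "valid_network S"
  shows "(\<Sum>i\<in>nodes S. u i * ((\<Sum>l\<in>lines_out S i. h l) - (\<Sum>l\<in>lines_in S i. h l)))
       = (\<Sum>l\<in>lines S. (u (fst l) - u (snd l)) * h l)"
proof -
  have fin: "finite (nodes S)" "finite (lines S)"
    and sub: "fst ` lines S \<subseteq> nodes S" "snd ` lines S \<subseteq> nodes S"
    using assms by (auto simp: valid_network_def)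
  have "(\<Sum>i\<in>nodes S. u i * (\<Sum>l\<in>{l \<in> lines S. e l = i}. h l)) = (\<Sum>l\<in>lines S. u (e l) * h l)"
    if "e ` lines S \<subseteq> nodes S" for e
    using sum.group[OF fin(2,1) that, of "\<lambda>l. u (e l) * h l"]
    by (simp add: sum_distrib_left)
  from this[OF sub(1)] this[OF sub(2)] show ?thesis
    by (simp add: lines_out_def lines_in_def right_diff_distrib left_diff_distrib sum_subtractf)
qed

lemma sum_nodes_gens_at:
  fixes u :: "'n \<Rightarrow> real" and h :: "'g \<Rightarrow> real"
  assumes "valid_network S"
  shows "(\<Sum>i\<in>nodes S. u i * (\<Sum>g\<in>gens_at S i. h g)) = (\<Sum>g\<in>gens S. u (gen_node S g) * h g)"
proof -
  have "finite (gens S)" "finite (nodes S)" "gen_node S ` gens S \<subseteq> nodes S"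
    using assms by (auto simp: valid_network_def)
  from sum.group[OF this, of "\<lambda>g. u (gen_node S g) * h g"] show ?thesis
    by (simp add: gens_at_def sum_distrib_left)
qed

text \<open>
  Needed for two price vectors, \<open>pi_var\<close> and \<open>LME\<close>. In the sum of the weighted flow balances each
  flow leaves one node and enters another, so only the price difference along its line remains.
\<close>

lemma priced_balance:
  assumes "valid_network S" and "dcopf_feasible S x"
  shows "(\<Sum>g\<in>gens S. u (gen_node S g) * PG x g) - (\<Sum>i\<in>nodes S. u i * demand S i)
       = (\<Sum>l\<in>lines S. (u (fst l) - u (snd l)) * flow x l)"
proof -
  have "u i * (\<Sum>g\<in>gens_at S i. PG x g) - u i * demand S i
      = u i * ((\<Sum>l\<in>lines_out S i. flow x l) - (\<Sum>l\<in>lines_in S i. flow x l))"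
    if "i \<in> nodes S" for i
  proof -
    have "balance_res S x i = 0" using assms(2) that by (simp add: dcopf_feasible_def)
    then have "(\<Sum>g\<in>gens_at S i. PG x g) - demand S i
        = (\<Sum>l\<in>lines_out S i. flow x l) - (\<Sum>l\<in>lines_in S i. flow x l)"
      unfolding balance_res_def by linarith
    then show ?thesis by (metis right_diff_distrib)
  qed
  then have "(\<Sum>i\<in>nodes S. u i * (\<Sum>g\<in>gens_at S i. PG x g) - u i * demand S i)
      = (\<Sum>i\<in>nodes S. u i * ((\<Sum>l\<in>lines_out S i. flow x l) - (\<Sum>l\<in>lines_in S i. flow x l)))"
    by (rule sum.cong[OF refl])
  then show ?thesis
    unfolding sum_node_net_outflow[OF assms(1)] by (simp add: sum_subtractf sum_nodes_gens_at assms(1))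
qed

text \<open>
  The Lagrangian is compared at \<open>x\<close> and at the same point with zero angles and flows. The flow
  equations hold at both, so only the flow balances and the flow limits contribute to the difference.
\<close>

lemma congestion_rent_emissions:
  fixes x :: "('n, 'g) combined_vars"
  assumes "valid_network S" and "dcopf_feasible S x"
    and const: "\<And>y y'. lagrangian S y p = lagrangian S y' p"
  shows "(\<Sum>l\<in>lines S. (p_pi p (fst l) - p_pi p (snd l)) * flow x l)
       = (\<Sum>l\<in>lines S. (p_rho_up p l + p_rho_lo p l) * flow x l)"
proof -
  define y where "y = x\<lparr>theta := \<lambda>i. 0, flow := \<lambda>l. 0\<rparr>"
  have flow_res: "(\<Sum>l\<in>lines S. p_z p l * flow_res S x l) = 0"
    "(\<Sum>l\<in>lines S. p_z p l * flow_res S y l) = 0"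
    using assms(2) by (auto simp: dcopf_feasible_def flow_res_def y_def)
  have bal: "(\<Sum>i\<in>nodes S. p_pi p i * balance_res S y i) = (\<Sum>i\<in>nodes S. p_pi p i * balance_res S x i)
      + (\<Sum>l\<in>lines S. (p_pi p (fst l) - p_pi p (snd l)) * flow x l)"
    unfolding sum_node_net_outflow[OF assms(1), symmetric] sum.distrib[symmetric]
    by (rule sum.cong) (simp_all add: y_def balance_res_def algebra_simps)
  have up: "(\<Sum>l\<in>lines S. p_rho_up p l * (flow y l - fmax S l))
      = (\<Sum>l\<in>lines S. p_rho_up p l * (flow x l - fmax S l)) - (\<Sum>l\<in>lines S. p_rho_up p l * flow x l)"
    "(\<Sum>l\<in>lines S. p_rho_lo p l * (flow y l - (- fmax S l)))
      = (\<Sum>l\<in>lines S. p_rho_lo p l * (flow x l - (- fmax S l)))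
        - (\<Sum>l\<in>lines S. p_rho_lo p l * flow x l)"
    unfolding sum_subtractf[symmetric]
    by (rule sum.cong; simp add: y_def algebra_simps)+
  have same: "emissions S y = emissions S x" "strong_duality_res S y = strong_duality_res S x"
    "dual_PG_res S y = dual_PG_res S x" "dual_flow_res S y = dual_flow_res S x"
    "dual_theta_res S y = dual_theta_res S x"
    "PG y = PG x" "rho_up y = rho_up x" "rho_lo y = rho_lo x"
    "gamma_up y = gamma_up x" "gamma_lo y = gamma_lo x"
    by (simp_all add: y_def emissions_def strong_duality_res_def dual_PG_res_def[abs_def]
        dual_flow_res_def[abs_def] dual_theta_res_def[abs_def])
  have "(\<Sum>l\<in>lines S. (p_pi p (fst l) - p_pi p (snd l)) * flow x l)
      = (\<Sum>l\<in>lines S. p_rho_up p l * flow x l) + (\<Sum>l\<in>lines S. p_rho_lo p l * flow x l)"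
    using const[of y x] unfolding lagrangian_def same flow_res bal up by linarith
  then show ?thesis by (simp add: distrib_right sum.distrib)
qed

text \<open>
  Price differences along a line are \<open>rho_up + rho_lo - z_var\<close>. The part with \<open>z_var\<close> sums to zero:
  after substituting the flow equation and summing by parts, the angles multiply the dual constraints
  that belong to them.
\<close>

lemma congestion_rent_cost:
  assumes "valid_network S" and "dcopf_feasible S x" and "dcopf_dual_feasible S x"
  shows "(\<Sum>l\<in>lines S. (pi_var x (fst l) - pi_var x (snd l)) * flow x l)
       = (\<Sum>l\<in>lines S. (rho_up x l + rho_lo x l) * flow x l)"
proof -
  have "(\<Sum>l\<in>lines S. z_var x l * flow x l)
      = (\<Sum>l\<in>lines S. (theta x (fst l) - theta x (snd l)) * (adm S l * z_var x l))"
  proof (rule sum.cong[OF refl])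
    fix l assume "l \<in> lines S"
    then have "flow_res S x l = 0" using assms(2) by (simp add: dcopf_feasible_def)
    then have "flow x l = adm S l * (theta x (fst l) - theta x (snd l))"
      by (simp add: flow_res_def)
    then show "z_var x l * flow x l
        = (theta x (fst l) - theta x (snd l)) * (adm S l * z_var x l)" by simp
  qed
  also have "\<dots> = (\<Sum>i\<in>nodes S. theta x i * dual_theta_res S x i)"
    unfolding dual_theta_res_def
    by (rule sum_node_net_outflow[OF assms(1), of "theta x", symmetric])
  also have "\<dots> = 0" using assms(3) by (simp add: dcopf_dual_feasible_def)
  finally have z: "(\<Sum>l\<in>lines S. z_var x l * flow x l) = 0" .
  have "(pi_var x (fst l) - pi_var x (snd l)) * flow x l
      = (rho_up x l + rho_lo x l) * flow x l - z_var x l * flow x l" if "l \<in> lines S" for l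
  proof -
    have "dual_flow_res S x l = 0" using assms(3) that by (simp add: dcopf_dual_feasible_def)
    then have "pi_var x (fst l) - pi_var x (snd l) = rho_up x l + rho_lo x l - z_var x l"
      by (simp add: dual_flow_res_def)
    then show ?thesis by (simp only: left_diff_distrib)
  qed
  then have "(\<Sum>l\<in>lines S. (pi_var x (fst l) - pi_var x (snd l)) * flow x l)
      = (\<Sum>l\<in>lines S. (rho_up x l + rho_lo x l) * flow x l - z_var x l * flow x l)"
    by (rule sum.cong[OF refl])
  then show ?thesis by (simp add: sum_subtractf z)
qed

text \<open>
  Weak duality of the DC-OPF in exact form: for feasible points, the duality gap is the sum of the
  slackness products, which the sign constraints make nonnegative.
\<close>

lemma strong_duality_res_eq_slackness:
  assumes "valid_network S" and "dcopf_feasible S x" and "dcopf_dual_feasible S x"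
  shows "strong_duality_res S x =
      (\<Sum>g\<in>gens S. gamma_up x g * (PG x g - Pmax S g))
    + (\<Sum>g\<in>gens S. gamma_lo x g * (PG x g - Pmin S g))
    + (\<Sum>l\<in>lines S. rho_up x l * (flow x l - fmax S l))
    + (\<Sum>l\<in>lines S. rho_lo x l * (flow x l - (- fmax S l)))"
proof -
  have "cost S g * PG x g
      = (gamma_up x g * PG x g + gamma_lo x g * PG x g) + pi_var x (gen_node S g) * PG x g"
    if "g \<in> gens S" for g
  proof -
    have "{i \<in> nodes S. g \<in> gens_at S i} = {gen_node S g}"
      using assms(1) that by (auto simp: gens_at_def valid_network_def)
    moreover have "dual_PG_res S x g = 0"
      using assms(3) that by (simp add: dcopf_dual_feasible_def)
    ultimately have "cost S g = gamma_up x g + gamma_lo x g + pi_var x (gen_node S g)"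
      by (simp add: dual_PG_res_def)
    then show ?thesis by (simp only: distrib_right)
  qed
  then have cost: "(\<Sum>g\<in>gens S. cost S g * PG x g) = (\<Sum>g\<in>gens S. gamma_up x g * PG x g)
      + (\<Sum>g\<in>gens S. gamma_lo x g * PG x g) + (\<Sum>g\<in>gens S. pi_var x (gen_node S g) * PG x g)"
    unfolding sum.distrib[symmetric] by (rule sum.cong[OF refl])
  have "(\<Sum>g\<in>gens S. pi_var x (gen_node S g) * PG x g) - (\<Sum>i\<in>nodes S. pi_var x i * demand S i)
      = (\<Sum>l\<in>lines S. (rho_up x l + rho_lo x l) * flow x l)"
    unfolding priced_balance[OF assms(1,2)] congestion_rent_cost[OF assms] ..
  then show ?thesis
    unfolding strong_duality_res_def cost
    by (simp add: right_diff_distrib distrib_right left_diff_distrib distrib_left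
        sum.distrib sum_subtractf)
qed

lemma dcopf_dual_slackness:
  assumes "valid_network S" and "combined_feasible S x" and "l \<in> lines S"
  shows "rho_up x l * (flow x l - fmax S l) = 0"
    and "rho_lo x l * (flow x l - (- fmax S l)) = 0"
proof -
  have feas: "dcopf_feasible S x" "dcopf_dual_feasible S x" "strong_duality_res S x \<le> 0"
    using assms(2) by (auto simp: combined_feasible_def)
  note feas' = feas(1,2)[unfolded dcopf_feasible_def dcopf_dual_feasible_def]
  have fin: "finite (lines S)" using assms(1) by (simp add: valid_network_def)
  let ?up = "\<lambda>l. rho_up x l * (flow x l - fmax S l)"
  let ?lo = "\<lambda>l. rho_lo x l * (flow x l - (- fmax S l))"
  have up: "?up l \<ge> 0" and lo: "?lo l \<ge> 0" if "l \<in> lines S" for l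
    using feas' that by (auto intro: mult_nonpos_nonpos mult_nonneg_nonneg)
  have "(\<Sum>g\<in>gens S. gamma_up x g * (PG x g - Pmax S g)) \<ge> 0"
    "(\<Sum>g\<in>gens S. gamma_lo x g * (PG x g - Pmin S g)) \<ge> 0"
    using feas' by (auto intro!: sum_nonneg simp: zero_le_mult_iff)
  moreover have "(\<Sum>l\<in>lines S. ?up l) \<ge> 0" "(\<Sum>l\<in>lines S. ?lo l) \<ge> 0"
    using up lo by (auto intro!: sum_nonneg)
  ultimately have "(\<Sum>l\<in>lines S. ?up l) = 0" "(\<Sum>l\<in>lines S. ?lo l) = 0"
    using feas(3) unfolding strong_duality_res_eq_slackness[OF assms(1) feas(1,2)] by linarith+
  then show "?up l = 0" "?lo l = 0"
    using sum_nonneg_eq_0_iff[OF fin, of ?up] sum_nonneg_eq_0_iff[OF fin, of ?lo]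
      up lo assms(3) by blast+
qed

text \<open>
  If \<open>a \<noteq> 0\<close> then \<open>f = m\<close>, and if \<open>b \<noteq> 0\<close> then \<open>f = - m\<close>; the bounds force \<open>m \<ge> 0\<close> and thus fix the
  sign of \<open>f\<close>.
\<close>

lemma slackness_abs_flow:
  fixes a b f m :: real
  assumes "a * (f - m) = 0" and "b * (f - (- m)) = 0" and "f \<le> m" and "f \<ge> - m"
  shows "(a + b) * f = (a - b) * \<bar>f\<bar>"
proof -
  have "a * f = a * \<bar>f\<bar>" using assms by auto
  moreover have "b * f = - (b * \<bar>f\<bar>)" using assms by auto
  ultimately show ?thesis by (simp add: distrib_right left_diff_distrib)
qed

theorem theorem5:
  fixes S :: "('n, 'g) network"
    and x :: "('n, 'g) combined_vars"
    and p :: "('n, 'g) multipliers"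
  assumes "valid_network S"
    and "combined_optimal S x"
    and "lagrangian_dual_optimal S p"
  shows "(\<Sum>g\<in>gens S. emis S g * PG x g) =
           (\<Sum>i\<in>nodes S. load_account S x p i)
         + (\<Sum>g\<in>gens S. gen_account S x p g)
         + (\<Sum>l\<in>lines S. line_account x p l)"
proof -
  have cfeas: "combined_feasible S x" and sgn: "multiplier_signs S p"
    using assms(2,3) by (auto simp: combined_optimal_def lagrangian_dual_optimal_def)
  then have feas: "dcopf_feasible S x" and dfeas: "dcopf_dual_feasible S x"
    by (auto simp: combined_feasible_def)
  note bound = dual_optimal_lagrangian_bound[OF assms]
  have const: "lagrangian S y p = lagrangian S y' p" for y y'
    using affine_bounded_below_imp_const[OF affine_along_shift_lagrangian bound] .
  let ?P = "p_rho_up p" and ?Q = "p_rho_lo p"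
  have lim: "flow x l \<le> fmax S l" "flow x l \<ge> - fmax S l" if "l \<in> lines S" for l
    using feas that by (auto simp: dcopf_feasible_def)
  have line: "line_account x p l
      = (?P l + ?Q l) * flow x l + p_o p * ((rho_up x l + rho_lo x l) * flow x l)"
    if l: "l \<in> lines S" for l
    unfolding slackness_abs_flow[OF flow_limit_slackness[OF assms(1) cfeas sgn bound l] lim[OF l]]
      slackness_abs_flow[OF dcopf_dual_slackness[OF assms(1) cfeas l] lim[OF l]]
    by (simp add: line_account_def SCI_def algebra_simps)
  have "(\<Sum>l\<in>lines S. line_account x p l) = (\<Sum>l\<in>lines S. (?P l + ?Q l) * flow x l)
      + p_o p * (\<Sum>l\<in>lines S. (rho_up x l + rho_lo x l) * flow x l)"
    by (simp add: line sum.distrib sum_distrib_left)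
  also have "\<dots> = (\<Sum>l\<in>lines S. (LME x p (fst l) - LME x p (snd l)) * flow x l)"
    unfolding congestion_rent_cost[OF assms(1) feas dfeas, symmetric]
      congestion_rent_emissions[OF assms(1) feas const, symmetric]
      sum_distrib_left sum.distrib[symmetric]
    by (rule sum.cong) (simp_all add: LME_def algebra_simps)
  also have "\<dots> = (\<Sum>g\<in>gens S. LME x p (gen_node S g) * PG x g)
      - (\<Sum>i\<in>nodes S. LME x p i * demand S i)"
    by (rule priced_balance[OF assms(1) feas, symmetric])
  finally show ?thesis
    by (simp add: load_account_def gen_account_def left_diff_distrib sum_subtractf)
qed

end
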